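(* Let $m$ be a positive integer, let $d>1$ be a real number, and let $P(x)$ be a monic real polynomial of degree $m$ whose coefficients are nonnegative and non-decreasing, with $P(x)\ne x^m$. Put $\overline m=\left\lceil \frac{m-d}{d+1}\right\rceil$ and $\overline{m+1}=\left\lceil \frac{m+1-d}{d+1}\right\rceil$. Suppose that one of the following conditions holds: (i) $\overline{m+1}=\overline m+1$; (ii) $\frac{m+1}{d+1}$ is a positive integer; (iii) $d\,\overline m$ is a positive integer; (iv) $d$ is a positive integer; (v) $\frac{m}{d+1}$ is a positive integer. Then $P(x+d)$ has the unique mode $\overline m$.
   Context: Coefficients of a polynomial $\sum_{i=0}^m a_ix^i$ are called non-decreasing if $a_0\le a_1\le\cdots\le a_m$. A sequence $b_0,\ldots,b_m$ of nonnegative real numbers is unimodal if there is an index $0\le t\le m$ with $b_0\le\cdots\le b_{t-1}\le b_t\ge b_{t+1}\ge\cdots\ge b_m$; any such index $t$ is called a mode of the sequence. A mode of a polynomial $\sum_{j=0}^m b_jx^j$ with nonnegative coefficients is a mode of its coefficient sequence $b_0,\ldots,b_m$. *)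

theory Defs
  imports Complex_Main "HOL-Computational_Algebra.Polynomial"
begin

text \<open>Finite sequences b(0), ..., b(m) are functions on nat of which only the
  values at indices up to m matter.\<close>

definition is_mode :: "(nat \<Rightarrow> real) \<Rightarrow> nat \<Rightarrow> nat \<Rightarrow> bool" where
  "is_mode b m t \<longleftrightarrow>
     (\<forall>i\<le>m. 0 \<le> b i) \<and> t \<le> m \<and>
     (\<forall>i<t. b i \<le> b (Suc i)) \<and>
     (\<forall>i. t \<le> i \<and> i < m \<longrightarrow> b (Suc i) \<le> b i)"

definition is_poly_mode :: "real poly \<Rightarrow> nat \<Rightarrow> bool" where
  "is_poly_mode p t \<longleftrightarrow> is_mode (coeff p) (degree p) t"

definition nondecreasing_coeffs :: "real poly \<Rightarrow> bool" where
  "nondecreasing_coeffs p \<longleftrightarrow> (\<forall>i<degree p. coeff p i \<le> coeff p (Suc i))"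

text \<open>The number written as m with an overline in the mathematical text; the overline
  on m + 1 is \<open>mbar d (m + 1)\<close>.\<close>

definition mbar :: "real \<Rightarrow> nat \<Rightarrow> int" where
  "mbar d m = \<lceil>(real m - d) / (d + 1)\<rceil>"

definition is_pos_integer :: "real \<Rightarrow> bool" where
  "is_pos_integer x \<longleftrightarrow> x \<in> \<int> \<and> 0 < x"

end

theory Submission
  imports Defs
begin

text \<open>
  The coefficient of \<open>x\<^sup>j\<close> in \<open>P(x + d)\<close> is \<open>\<Sum>i. a\<^sub>i c\<^sub>i\<^sub>j\<close>, where \<open>a\<^sub>i\<close> are the coefficients of \<open>P\<close>
  and \<open>c\<^sub>i\<^sub>j\<close> is the coefficient of \<open>x\<^sup>j\<close> in \<open>(x + d)\<^sup>i\<close>. The increment \<open>c\<^sub>i\<^sub>k - c\<^sub>i\<^sub>j\<close> with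
  \<open>k = j + 1\<close> has the sign of \<open>i + 1 - (d + 1) k\<close> as long as \<open>j \<le> i\<close>
  (\<open>shift_coeff_increment\<close>), so for fixed \<open>j\<close> it changes sign once, from minus to plus,
  as \<open>i\<close> grows. The proof compares this threshold with \<open>m\<close>.

  If \<open>m + 1 \<le> (d + 1) k\<close>, which means that \<open>j\<close> is at least the claimed mode, then no power
  contributes a positive increment. A non-decreasing \<open>P \<noteq> x\<^sup>m\<close> has \<open>a\<^bsub>m-1\<^esub> > 0\<close>, and the power
  \<open>m - 1\<close> contributes a negative one, so the coefficients of \<open>P(x + d)\<close> strictly decrease at \<open>j\<close>
  (\<open>coeffs_decrease\<close>).

  If \<open>(d + 1) k \<le> m\<close>, then the increments of all \<open>(x + d)\<^sup>i\<close> with \<open>i \<le> m\<close> have a positive sum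
  (\<open>sum_increments_pos\<close>). Since the \<open>a\<^sub>i\<close> are non-decreasing, they put the larger weights on
  the positive increments, so the weighted sum is positive as well and the coefficients strictly
  increase at \<open>j\<close> (\<open>coeffs_increase\<close>).

  Between these two ranges of \<open>j\<close> lies the gap \<open>m < (d + 1) k < m + 1\<close>, which contains no \<open>k\<close>
  other than possibly the claimed mode itself. Each of the five conditions excludes it
  (\<open>mbar_gap_excluded\<close>): they all imply \<open>(d + 1) k \<le> m\<close> when \<open>k\<close> is the claimed mode.
\<close>

section \<open>Coefficients of powers of a linear polynomial\<close>

definition shift_coeff :: "real \<Rightarrow> nat \<Rightarrow> nat \<Rightarrow> real" where
  "shift_coeff d i j = real (i choose j) * d ^ (i - j)"

lemma pcompose_as_sum:
  fixes p q :: "'a :: comm_semiring_1 poly"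
  shows "pcompose p q = (\<Sum>i\<le>degree p. smult (coeff p i) (q ^ i))"
proof -
  have monom: "pcompose (monom a i) q = smult a (q ^ i)" for a i
    by (induction i) (simp_all add: monom_0 monom_Suc pcompose_pCons)
  have "pcompose (\<Sum>i\<in>A. monom (coeff p i) i) q = (\<Sum>i\<in>A. smult (coeff p i) (q ^ i))"
    if "finite A" for A
    using that by (induction A rule: finite_induct) (simp_all add: pcompose_add monom)
  from this[of "{..degree p}"] show ?thesis
    by (simp add: poly_as_sum_of_monoms)
qed

lemma coeff_pcompose_shift:
  "coeff (pcompose P [:d, 1:]) j = (\<Sum>i\<le>degree P. coeff P i * shift_coeff d i j)"
proof -
  have "coeff ([:d, 1:] ^ i) j = shift_coeff d i j" for i
  proof (cases "j \<le> i")
    case True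
    then show ?thesis
      by (simp add: coeff_linear_poly_power shift_coeff_def)
  next
    case False
    moreover have "degree ([:d, 1:] ^ i) \<le> i"
      using degree_power_le[of "[:d, 1:]" i] by simp
    ultimately show ?thesis
      by (simp add: coeff_eq_0 shift_coeff_def)
  qed
  then show ?thesis
    by (simp add: pcompose_as_sum coeff_sum)
qed

lemma shift_coeff_nonneg: "0 \<le> d \<Longrightarrow> 0 \<le> shift_coeff d i j"
  by (simp add: shift_coeff_def)

lemma shift_coeff_pos: "0 < d \<Longrightarrow> j \<le> i \<Longrightarrow> 0 < shift_coeff d i j"
  by (simp add: shift_coeff_def)

lemma shift_coeff_eq_0: "i < j \<Longrightarrow> shift_coeff d i j = 0"
  by (simp add: shift_coeff_def)

lemma shift_coeff_pascal:
  "shift_coeff d (Suc i) (Suc j) = shift_coeff d i j + d * shift_coeff d i (Suc j)"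
proof (cases "Suc j \<le> i")
  case True
  then have "i - j = Suc (i - Suc j)" by simp
  then show ?thesis
    by (simp add: shift_coeff_def algebra_simps)
qed (simp add: shift_coeff_def)

lemma shift_coeff_Suc_right:
  "d * real (Suc j) * shift_coeff d i (Suc j) = (real i - real j) * shift_coeff d i j"
proof (cases "Suc j \<le> i")
  case True
  have "Suc j * (i choose Suc j) = (i - j) * (i choose j)"
    by (simp only: binomial_absorption binomial_absorb_comp)
  then have "real (Suc j) * real (i choose Suc j) = (real i - real j) * real (i choose j)"
    using True by (metis Suc_leD of_nat_diff of_nat_mult)
  moreover have "d ^ (i - j) = d * d ^ (i - Suc j)"
    using True by (metis Suc_diff_le diff_Suc_Suc power_Suc)
  ultimately show ?thesis
    unfolding shift_coeff_def by (metis mult.assoc mult.left_commute)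
next
  case False
  then have "i = j \<or> i < j" by linarith
  then show ?thesis
    by (auto simp: shift_coeff_eq_0)
qed

lemma shift_coeff_Suc_left:
  "(real (Suc i) - real k) * shift_coeff d (Suc i) k = d * real (Suc i) * shift_coeff d i k"
proof (cases "k \<le> i")
  case True
  have "(Suc i - k) * (Suc i choose k) = Suc i * (i choose k)"
    using binomial_absorb_comp[of "Suc i" k] by simp
  then have "(real (Suc i) - real k) * real (Suc i choose k) = real (Suc i) * real (i choose k)"
    using True by (metis le_SucI of_nat_diff of_nat_mult)
  moreover have "d ^ (Suc i - k) = d * d ^ (i - k)"
    using True by (simp add: Suc_diff_le)
  ultimately show ?thesis
    unfolding shift_coeff_def by (metis mult.assoc mult.left_commute)
next
  case False
  then have "k = Suc i \<or> Suc i < k" by linarith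
  then show ?thesis
    by (auto simp: shift_coeff_eq_0)
qed

lemma shift_coeff_increment:
  "d * real (Suc j) * (shift_coeff d i (Suc j) - shift_coeff d i j)
     = (real i + 1 - (d + 1) * real (Suc j)) * shift_coeff d i j"
  using shift_coeff_Suc_right[of d j i] by (simp add: algebra_simps)

lemma shift_coeff_increment_nonneg:
  assumes "0 < d" "(d + 1) * real (Suc j) \<le> real i + 1"
  shows "0 \<le> shift_coeff d i (Suc j) - shift_coeff d i j"
proof -
  have "0 \<le> d * real (Suc j) * (shift_coeff d i (Suc j) - shift_coeff d i j)"
    unfolding shift_coeff_increment using assms by (simp add: shift_coeff_nonneg)
  then show ?thesis
    using assms(1)
    by (simp add: zero_le_mult_iff mult_le_0_iff zero_less_mult_iff mult_less_0_iff del: of_nat_Suc)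
qed

lemma shift_coeff_increment_pos:
  assumes "0 < d" "j \<le> i" "(d + 1) * real (Suc j) < real i + 1"
  shows "0 < shift_coeff d i (Suc j) - shift_coeff d i j"
proof -
  have "0 < d * real (Suc j) * (shift_coeff d i (Suc j) - shift_coeff d i j)"
    unfolding shift_coeff_increment using assms by (simp add: shift_coeff_pos)
  then show ?thesis
    using assms(1)
    by (simp add: zero_le_mult_iff mult_le_0_iff zero_less_mult_iff mult_less_0_iff del: of_nat_Suc)
qed

lemma shift_coeff_increment_nonpos:
  assumes "0 < d" "real i + 1 \<le> (d + 1) * real (Suc j)"
  shows "shift_coeff d i (Suc j) - shift_coeff d i j \<le> 0"
proof -
  have "d * real (Suc j) * (shift_coeff d i (Suc j) - shift_coeff d i j) \<le> 0"
    unfolding shift_coeff_increment using assms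
    by (intro mult_nonpos_nonneg) (simp_all add: shift_coeff_nonneg)
  then show ?thesis
    using assms(1)
    by (simp add: zero_le_mult_iff mult_le_0_iff zero_less_mult_iff mult_less_0_iff del: of_nat_Suc)
qed

lemma shift_coeff_increment_neg:
  assumes "0 < d" "j \<le> i" "real i + 1 < (d + 1) * real (Suc j)"
  shows "shift_coeff d i (Suc j) - shift_coeff d i j < 0"
proof -
  have "d * real (Suc j) * (shift_coeff d i (Suc j) - shift_coeff d i j) < 0"
    unfolding shift_coeff_increment using assms
    by (intro mult_neg_pos) (simp_all add: shift_coeff_pos)
  then show ?thesis
    using assms(1)
    by (simp add: zero_le_mult_iff mult_le_0_iff zero_less_mult_iff mult_less_0_iff del: of_nat_Suc)
qed

section \<open>Positivity of the unweighted sum of increments\<close>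

text \<open>
  With \<open>k = j + 1\<close>, this is the coefficient of \<open>x\<^sup>k\<close> in
  \<open>(x + d - 1) (\<Sum>i\<le>m. (x + d)\<^sup>i) = (x + d)\<^bsup>m+1\<^esup> - 1\<close>. It leaves
  only sums in the column \<open>k\<close> to be estimated.
\<close>
lemma sum_increments_eq:
  "(\<Sum>i\<le>m. shift_coeff d i (Suc j) - shift_coeff d i j)
     = d * (\<Sum>i\<le>m. shift_coeff d i (Suc j)) - shift_coeff d (Suc m) (Suc j)"
proof (induction m)
  case 0
  show ?case
    using shift_coeff_pascal[of d 0 j] by (simp add: shift_coeff_eq_0)
next
  case (Suc m)
  then show ?case
    using shift_coeff_pascal[of d "Suc m" j] by (simp add: algebra_simps)
qed

text \<open>
  Telescoping the sequence \<open>W\<close> below. It satisfies \<open>W (i + 1) = (i + 1) c\<^sub>i\<^sub>k\<close>, where \<open>c\<^sub>i\<^sub>k\<close> is the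
  coefficient of \<open>x\<^sup>k\<close> in \<open>(x + d)\<^sup>i\<close>, so the ratio of \<open>W (i + 1) - W i\<close> to \<open>c\<^sub>i\<^sub>k\<close> is
  \<open>i + 1 - (i - k) / d\<close>. As \<open>d > 1\<close>, this ratio is increasing in \<open>i\<close>, and by
  \<open>(d + 1) k \<le> m\<close> its value at \<open>i = m\<close> is at most \<open>m + 1 - k\<close>. Summing over \<open>i\<close> bounds
  \<open>W (m + 1)\<close>, which is the right-hand side up to the factor \<open>(m + 1 - k) / d\<close>.
\<close>
lemma sum_shift_coeff_lower_bound:
  assumes d: "1 < d" and k: "0 < k" and le: "(d + 1) * real k \<le> real m"
  shows "shift_coeff d (Suc m) k < d * (\<Sum>i\<le>m. shift_coeff d i k)"
proof -
  define W where "W i = (real i - real k) * shift_coeff d i k / d" for i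
  have "real k < d * real k"
    using d k by simp
  then have km: "2 * real k < real m"
    using le by (simp add: algebra_simps)
  have W_Suc: "W (Suc i) = real (Suc i) * shift_coeff d i k" for i
    using shift_coeff_Suc_left[of i k d] d by (simp add: W_def)
  have diff: "W (Suc i) - W i = (real i + 1 - (real i - real k) / d) * shift_coeff d i k" for i
    unfolding W_Suc by (simp add: W_def algebra_simps)
  have slack: "real i + 1 - (real i - real k) / d
      \<le> real m + 1 - real k - (real m - real i) * (1 - 1 / d)" for i
  proof -
    have "real k \<le> (real m - real k) / d"
      using le d by (simp add: field_simps)
    then show ?thesis
      by (simp add: algebra_simps diff_divide_distrib)
  qed
  have step: "W (Suc i) - W i \<le> (real m + 1 - real k) * shift_coeff d i k" if "i \<le> m" for i
  proof -
    have "0 \<le> (real m - real i) * (1 - 1 / d)"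
      using that d by simp
    then show ?thesis
      unfolding diff using slack[of i] d
      by (intro mult_right_mono) (simp_all add: shift_coeff_nonneg)
  qed
  \<comment> \<open>any index between \<open>k\<close> and \<open>m - 1\<close> would do: the ratio is below its value at \<open>m\<close>\<close>
  have strict: "W (Suc k) - W k < (real m + 1 - real k) * shift_coeff d k k"
  proof -
    have "0 < (real m - real k) * (1 - 1 / d)"
      using km d by simp
    then show ?thesis
      unfolding diff using slack[of k] d
      by (intro mult_strict_right_mono) (simp_all add: shift_coeff_pos)
  qed
  have "W (Suc m) - W 0 = (\<Sum>i<Suc m. W (Suc i) - W i)"
    by (rule sum_lessThan_telescope [symmetric])
  also have "\<dots> < (\<Sum>i<Suc m. (real m + 1 - real k) * shift_coeff d i k)"
  proof (rule sum_strict_mono_ex1)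
    show "\<forall>i\<in>{..<Suc m}. W (Suc i) - W i \<le> (real m + 1 - real k) * shift_coeff d i k"
      using step by auto
    show "\<exists>i\<in>{..<Suc m}. W (Suc i) - W i < (real m + 1 - real k) * shift_coeff d i k"
      using strict km by (intro bexI[of _ k]) auto
  qed simp
  also have "\<dots> = (real m + 1 - real k) * (\<Sum>i\<le>m. shift_coeff d i k)"
    by (simp only: lessThan_Suc_atMost sum_distrib_left)
  finally have "W (Suc m) < (real m + 1 - real k) * (\<Sum>i\<le>m. shift_coeff d i k)"
    using k by (simp add: W_def shift_coeff_eq_0)
  then have "(real m + 1 - real k) * shift_coeff d (Suc m) k
      < (real m + 1 - real k) * (d * (\<Sum>i\<le>m. shift_coeff d i k))"
    using d by (simp add: W_def field_simps)
  then show ?thesis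
    using km by (subst (asm) mult_less_cancel_left_pos) auto
qed

lemma sum_increments_pos:
  assumes "1 < d" "(d + 1) * real (Suc j) \<le> real m"
  shows "0 < (\<Sum>i\<le>m. shift_coeff d i (Suc j) - shift_coeff d i j)"
  using sum_shift_coeff_lower_bound[of d "Suc j" m] assms by (simp add: sum_increments_eq)

section \<open>Monotonicity of the coefficients of the shifted polynomial\<close>

lemma nondecreasing_coeffsD:
  assumes "nondecreasing_coeffs P" "i \<le> i'" "i' \<le> degree P"
  shows "coeff P i \<le> coeff P i'"
  using assms(2,3)
proof (induction i' rule: dec_induct)
  case (step n)
  moreover have "coeff P n \<le> coeff P (Suc n)"
    using assms(1) step.prems by (simp add: nondecreasing_coeffs_def)
  ultimately show ?case by simp
qed simp

lemma coeff_pcompose_shift_increment: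
  "coeff (pcompose P [:d, 1:]) (Suc j) - coeff (pcompose P [:d, 1:]) j
     = (\<Sum>i\<le>degree P. coeff P i * (shift_coeff d i (Suc j) - shift_coeff d i j))"
  by (simp add: coeff_pcompose_shift sum_subtractf right_diff_distrib)

text \<open>
  A summation of Chebyshev type. Let \<open>i0\<close> be the first index from which the increments are
  nonnegative. Replacing every weight by the weight at \<open>i0\<close> lowers the weights of the
  nonnegative increments and raises those of the nonpositive ones, so it can only decrease the sum.
  If the weight at \<open>i0\<close> is positive, the resulting sum is a positive multiple of the unweighted
  one. If it is 0, then replacing it is a strict loss in the leading term.
\<close>
lemma coeffs_increase:
  assumes d: "1 < d" and lead: "0 < lead_coeff P" and nonneg: "\<forall>i. 0 \<le> coeff P i"
    and mono: "nondecreasing_coeffs P" and le: "(d + 1) * real (Suc j) \<le> real (degree P)"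
  shows "coeff (pcompose P [:d, 1:]) j < coeff (pcompose P [:d, 1:]) (Suc j)"
proof -
  define m where "m = degree P"
  define D where "D i = shift_coeff d i (Suc j) - shift_coeff d i j" for i
  define i0 where "i0 = nat \<lceil>(d + 1) * real (Suc j) - 1\<rceil>"
  define a where "a = coeff P i0"
  have i0: "i0 \<le> i \<longleftrightarrow> (d + 1) * real (Suc j) \<le> real i + 1" for i
    unfolding i0_def by (simp add: nat_le_iff ceiling_le_iff algebra_simps)
  have i0m: "i0 \<le> m"
    using le unfolding i0 m_def by simp
  have "real (Suc j) \<le> (d + 1) * real (Suc j)"
    using d by (simp add: algebra_simps)
  then have jm: "j \<le> m"
    using le unfolding m_def by linarith
  have Dm: "0 < D m"
    unfolding D_def using d jm le by (intro shift_coeff_increment_pos) (auto simp: m_def)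
  have term_nonneg: "0 \<le> (coeff P i - a) * D i" if "i \<le> m" for i
  proof (cases "i0 \<le> i")
    case True
    then have "0 \<le> D i"
      unfolding D_def using d i0 by (intro shift_coeff_increment_nonneg) auto
    moreover have "a \<le> coeff P i"
      unfolding a_def using mono True that by (intro nondecreasing_coeffsD) (auto simp: m_def)
    ultimately show ?thesis by simp
  next
    case False
    then have "D i \<le> 0"
      unfolding D_def using d i0[of i] by (intro shift_coeff_increment_nonpos) auto
    moreover have "coeff P i \<le> a"
      unfolding a_def using mono False i0m by (intro nondecreasing_coeffsD) (auto simp: m_def)
    ultimately show ?thesis by (simp add: mult_nonpos_nonpos)
  qed
  have "(coeff P m - a) * D m \<le> (\<Sum>i\<le>m. (coeff P i - a) * D i)"
    using term_nonneg by (intro member_le_sum) auto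
  also have "\<dots> = (\<Sum>i\<le>m. coeff P i * D i) - a * (\<Sum>i\<le>m. D i)"
    by (simp add: left_diff_distrib sum_subtractf sum_distrib_left)
  finally have bound: "(coeff P m - a) * D m + a * (\<Sum>i\<le>m. D i) \<le> (\<Sum>i\<le>m. coeff P i * D i)"
    by simp
  have "a \<le> coeff P m"
    unfolding a_def using mono i0m by (intro nondecreasing_coeffsD) (auto simp: m_def)
  have sum_pos: "0 < (\<Sum>i\<le>m. D i)"
    unfolding D_def using d le by (intro sum_increments_pos) (auto simp: m_def)
  have "0 < (coeff P m - a) * D m + a * (\<Sum>i\<le>m. D i)"
  proof (cases "a = 0")
    case True
    then show ?thesis
      using lead Dm by (simp add: m_def)
  next
    case False
    then have "0 < a"
      using nonneg by (simp add: a_def less_le)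
    then show ?thesis
      using \<open>a \<le> coeff P m\<close> Dm sum_pos by (intro add_nonneg_pos) simp_all
  qed
  with bound show ?thesis
    using coeff_pcompose_shift_increment[of P d j] by (simp add: D_def m_def)
qed

text \<open>
  The term of index \<open>degree P\<close> may vanish, in the case of equality in the last assumption; the
  term just below it is the one that makes the inequality strict.
\<close>
lemma coeffs_decrease:
  assumes d: "0 < d" and nonneg: "\<forall>i. 0 \<le> coeff P i"
    and pos: "0 < coeff P (degree P - 1)" and j: "j < degree P"
    and ge: "real (degree P) + 1 \<le> (d + 1) * real (Suc j)"
  shows "coeff (pcompose P [:d, 1:]) (Suc j) < coeff (pcompose P [:d, 1:]) j"
proof -
  define D where "D i = coeff P i * (shift_coeff d i (Suc j) - shift_coeff d i j)" for i
  have "(\<Sum>i\<le>degree P. D i) < (\<Sum>i\<le>degree P. 0)"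
  proof (rule sum_strict_mono_ex1)
    show "\<forall>i\<in>{..degree P}. D i \<le> 0"
      unfolding D_def using d nonneg ge
      by (intro ballI mult_nonneg_nonpos shift_coeff_increment_nonpos) auto
    have "D (degree P - 1) < 0"
      unfolding D_def using d pos j ge
      by (intro mult_pos_neg shift_coeff_increment_neg) (auto simp: of_nat_diff)
    then show "\<exists>i\<in>{..degree P}. D i < 0"
      by (intro bexI[of _ "degree P - 1"]) auto
  qed simp
  then show ?thesis
    using coeff_pcompose_shift_increment[of P d j] by (simp add: D_def)
qed

lemma nondecreasing_coeffs_pred_pos:
  assumes nonneg: "\<forall>i. 0 \<le> coeff P i" and mono: "nondecreasing_coeffs P"
    and ne: "P \<noteq> monom (lead_coeff P) (degree P)"
  shows "0 < coeff P (degree P - 1)"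
proof (rule ccontr)
  assume "\<not> 0 < coeff P (degree P - 1)"
  then have zero: "coeff P i = 0" if "i < degree P" for i
    using nondecreasing_coeffsD[OF mono, of i "degree P - 1"] nonneg that
    by (metis One_nat_def Suc_pred diff_le_self less_Suc_eq_le less_le_trans not_le
        order_antisym zero_le order_le_less)
  have "P = monom (lead_coeff P) (degree P)"
    by (rule poly_eqI) (metis coeff_eq_0 coeff_monom linorder_neqE_nat zero)
  with ne show False by simp
qed

section \<open>The claimed mode\<close>

lemma unique_mode:
  assumes "\<forall>i\<le>m. 0 \<le> b i" "k \<le> m"
    and inc: "\<And>i. i < k \<Longrightarrow> b i < b (Suc i)"
    and dec: "\<And>i. k \<le> i \<Longrightarrow> i < m \<Longrightarrow> b (Suc i) < b i"
  shows "is_mode b m t \<longleftrightarrow> t = k"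
proof
  assume t: "is_mode b m t"
  show "t = k"
  proof (rule linorder_cases[of t k])
    assume "t < k"
    then show ?thesis
      using t inc[of t] assms(2) by (force simp: is_mode_def)
  next
    assume "k < t"
    then show ?thesis
      using t dec[of k] by (force simp: is_mode_def)
  qed
next
  assume "t = k"
  then show "is_mode b m t"
    using assms by (auto simp: is_mode_def intro: less_imp_le)
qed

lemma less_mbar_iff:
  assumes "0 < d"
  shows "int j < mbar d m \<longleftrightarrow> (d + 1) * real (Suc j) < real m + 1"
proof -
  have "int j < mbar d m \<longleftrightarrow> real j < (real m - d) / (d + 1)"
    unfolding mbar_def by (simp add: less_ceiling_iff)
  also have "\<dots> \<longleftrightarrow> (d + 1) * real (Suc j) < real m + 1"
    using assms by (simp add: pos_less_divide_eq algebra_simps)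
  finally show ?thesis .
qed

lemma mbar_bounds:
  assumes "0 < d"
  shows "0 \<le> mbar d m" "mbar d m \<le> int m"
proof -
  have "-1 < (real m - d) / (d + 1)"
    using assms by (simp add: pos_less_divide_eq)
  then show "0 \<le> mbar d m"
    unfolding mbar_def by linarith
  have "0 < d * real (Suc m)"
    using assms by simp
  then have "\<not> int m < mbar d m"
    unfolding less_mbar_iff[OF assms] by (simp add: algebra_simps)
  then show "mbar d m \<le> int m" by simp
qed

text \<open>
  The definition of \<open>mbar\<close> only gives \<open>(d + 1) * mbar d m < m + 1\<close>. There are two ways to do
  better. If \<open>(d + 1) * mbar d m\<close> is an integer, then it is at most \<open>m\<close>: this settles the cases
  where \<open>d\<close> or \<open>d * mbar d m\<close> is an integer. The other three cases
  locate \<open>mbar d m\<close> more precisely. If \<open>mbar d (m + 1) = mbar d m + 1\<close>, the defining inequality for \<open>m + 1\<close> at the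
  index \<open>mbar d m\<close> leaves room to spare; if \<open>(m + 1) / (d + 1) = N\<close> then \<open>mbar d m = N - 1\<close>;
  if \<open>m / (d + 1) = N\<close> then \<open>mbar d m = N\<close>.
\<close>
lemma mbar_gap_excluded:
  assumes d: "1 < d"
    and cond: "mbar d (m + 1) = mbar d m + 1
       \<or> is_pos_integer (real (m + 1) / (d + 1))
       \<or> is_pos_integer (d * of_int (mbar d m))
       \<or> is_pos_integer d
       \<or> is_pos_integer (real m / (d + 1))"
  shows "(d + 1) * of_int (mbar d m) \<le> real m"
proof -
  define k where "k = mbar d m"
  have k_less: "of_int k < (real m - d) / (d + 1) + 1"
    unfolding k_def mbar_def by linarith
  then have upper: "(d + 1) * of_int k < real m + 1"
    using d by (simp add: field_simps)
  have integral: "(d + 1) * of_int k \<le> real m" if "d * of_int k \<in> \<int>"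
  proof -
    from that obtain z where z: "d * of_int k = of_int z"
      by (elim Ints_cases)
    then have eq: "(d + 1) * of_int k = of_int (z + k)"
      by (simp add: algebra_simps)
    have "of_int (z + k) < (of_int (int m + 1) :: real)"
      using upper unfolding eq by simp
    then have "z + k \<le> int m"
      unfolding of_int_less_iff by simp
    then have "of_int (z + k) \<le> (of_int (int m) :: real)"
      by (simp only: of_int_le_iff)
    then show ?thesis
      unfolding eq by simp
  qed
  consider (succ) "mbar d (m + 1) = k + 1" | (Suc_m) "real (m + 1) / (d + 1) \<in> \<int>"
    | (dk) "d * of_int k \<in> \<int>" | (d) "d \<in> \<int>" | (m) "real m / (d + 1) \<in> \<int>"
    using cond by (auto simp: is_pos_integer_def k_def)
  then have "(d + 1) * of_int k \<le> real m"
  proof cases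
    case succ
    then have "of_int k < (real (m + 1) - d) / (d + 1)"
      unfolding mbar_def by linarith
    then show ?thesis
      using d by (simp add: field_simps)
  next
    case Suc_m
    then obtain N where N: "real (m + 1) / (d + 1) = of_int N"
      by (elim Ints_cases)
    have "(real m - d) / (d + 1) = real (m + 1) / (d + 1) - 1"
      using d by (simp add: field_simps)
    then have "(real m - d) / (d + 1) = of_int (N - 1)"
      using N by simp
    then have "of_int k = (real m - d) / (d + 1)"
      unfolding k_def mbar_def by (simp only: ceiling_of_int)
    then show ?thesis
      using d by (simp add: field_simps)
  next
    case m
    then obtain N where N: "real m / (d + 1) = of_int N"
      by (elim Ints_cases)
    have "(real m - d) / (d + 1) + 1 = real m / (d + 1) + 1 / (d + 1)"
      using d by (simp add: field_simps)
    moreover have "1 / (d + 1) < 1"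
      using d by simp
    ultimately have "of_int k < (of_int (N + 1) :: real)"
      using k_less N by simp
    then have "k \<le> N"
      unfolding of_int_less_iff by simp
    then have "of_int k \<le> real m / (d + 1)"
      using N by simp
    then show ?thesis
      using d by (simp add: field_simps)
  qed (auto intro!: integral)
  then show ?thesis
    by (simp add: k_def)
qed

theorem corollary4p3:
  fixes m :: nat and d :: real and P :: "real poly"
  assumes "0 < m"
    and "1 < d"
    and "degree P = m"
    and "lead_coeff P = 1"
    and "\<forall>i. 0 \<le> coeff P i"
    and "nondecreasing_coeffs P"
    and "P \<noteq> monom 1 m"
    and "mbar d (m + 1) = mbar d m + 1
       \<or> is_pos_integer (real (m + 1) / (d + 1))
       \<or> is_pos_integer (d * of_int (mbar d m))
       \<or> is_pos_integer d
       \<or> is_pos_integer (real m / (d + 1))"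
  shows "int ` {t. is_poly_mode (pcompose P [:d, 1:]) t} = {mbar d m}"
proof -
  define k where "k = nat (mbar d m)"
  let ?b = "coeff (pcompose P [:d, 1:])"
  have d0: "0 < d"
    using assms(2) by simp
  have k: "int k = mbar d m"
    using mbar_bounds[OF d0, of m] by (simp add: k_def)
  have gap: "(d + 1) * real k \<le> real m"
    using mbar_gap_excluded[OF assms(2,8)] k by (metis of_int_of_nat_eq)
  have deg: "degree (pcompose P [:d, 1:]) = m"
    using assms(3) by (simp add: degree_pcompose)
  have "is_mode ?b m t \<longleftrightarrow> t = k" for t
  proof (rule unique_mode)
    show "\<forall>i\<le>m. 0 \<le> ?b i"
      unfolding coeff_pcompose_shift using assms(5) d0
      by (intro allI impI sum_nonneg mult_nonneg_nonneg shift_coeff_nonneg) auto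
    show "k \<le> m"
      using mbar_bounds[OF d0, of m] k by linarith
  next
    fix j assume "j < k"
    then have "(d + 1) * real (Suc j) \<le> (d + 1) * real k"
      using d0 by (intro mult_left_mono) auto
    with gap have "(d + 1) * real (Suc j) \<le> real (degree P)"
      unfolding assms(3) by (rule order_trans [rotated])
    then show "?b j < ?b (Suc j)"
      using assms(2,4-6) by (intro coeffs_increase) simp_all
  next
    fix j assume "k \<le> j" "j < m"
    then have "\<not> int j < mbar d m"
      using k by linarith
    then have "real m + 1 \<le> (d + 1) * real (Suc j)"
      unfolding less_mbar_iff[OF d0] by simp
    moreover have "0 < coeff P (degree P - 1)"
      using assms by (intro nondecreasing_coeffs_pred_pos) auto
    ultimately show "?b (Suc j) < ?b j"
      using assms d0 \<open>j < m\<close> by (intro coeffs_decrease) auto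
  qed
  then show ?thesis
    by (simp add: is_poly_mode_def deg k)
qed

end
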